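(* Every strongly maximal element of a continuous dcpo is sharp.
   Context: Everything is constructive: neither excluded middle nor choice is assumed. A subset $S$ of a poset is directed if it is inhabited and any two elements of $S$ have an upper bound in $S$. A dcpo is a poset $(D,\sqsubseteq)$ in which every directed subset $S$ has a supremum $\bigsqcup S$. Write $x\ll y$ ($x$ is way below $y$) if for every directed $S$ with $y\sqsubseteq\bigsqcup S$ there is $s\in S$ with $x\sqsubseteq s$. $D$ is continuous if for every $x$ the set $\{y\in D\mid y\ll x\}$ is directed with supremum $x$. A subset $U\subseteq D$ is Scott open if it is an upper set and whenever $\bigsqcup S\in U$ with $S$ directed, some $s\in S$ is in $U$. Two points of $D$ are Hausdorff separated if they have disjoint Scott open neighbourhoods. An element $x$ of a continuous dcpo $D$ is strongly maximal if for every $u,v\in D$ with $u\ll v$, we have $u\ll x$, or $v$ and $x$ are Hausdorff separated. An element $x\in D$ is sharp if for every $y,z\in D$ with $y\ll z$ we have $y\ll x$ or $\lnot(z\sqsubseteq x)$. *)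

theory Defs
  imports Main
begin

text \<open>
  In the classical logic of HOL every element is sharp, because \<open>y \<ll> z \<sqsubseteq> x\<close> implies \<open>y \<ll> x\<close>.
  To keep the constructive content, the domain theory is therefore read in intuitionistic
  higher-order logic with truth values in an arbitrary complete Heyting algebra
  (Higgs, Fourman and Scott), in which neither excluded middle nor choice holds in general.
  Bold symbols are the connectives and quantifiers of that logic.  For the truth values
  \<open>bool\<close> it is classical logic.
\<close>

class complete_heyting_algebra = complete_lattice +
  assumes inf_Sup_le: "inf a (Sup B) \<le> (SUP b\<in>B. inf a b)"

instance bool :: complete_heyting_algebra
  by standard auto

abbreviation hFalse :: "'h::complete_heyting_algebra" ("\<^bold>\<bottom>")
  where "\<^bold>\<bottom> \<equiv> bot"

abbreviation hTrue :: "'h::complete_heyting_algebra" ("\<^bold>\<top>")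
  where "\<^bold>\<top> \<equiv> top"

abbreviation hConj :: "'h::complete_heyting_algebra \<Rightarrow> 'h \<Rightarrow> 'h" (infixr "\<^bold>\<and>" 35)
  where "p \<^bold>\<and> q \<equiv> inf p q"

abbreviation hDisj :: "'h::complete_heyting_algebra \<Rightarrow> 'h \<Rightarrow> 'h" (infixr "\<^bold>\<or>" 30)
  where "p \<^bold>\<or> q \<equiv> sup p q"

definition hImp :: "'h::complete_heyting_algebra \<Rightarrow> 'h \<Rightarrow> 'h" (infixr "\<^bold>\<longrightarrow>" 25)
  where "(p \<^bold>\<longrightarrow> q) = Sup {r. inf r p \<le> q}"

abbreviation hNot :: "'h::complete_heyting_algebra \<Rightarrow> 'h" ("\<^bold>\<not> _" [40] 40)
  where "\<^bold>\<not> p \<equiv> (p \<^bold>\<longrightarrow> \<^bold>\<bottom>)"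

definition valid :: "'h::complete_heyting_algebra \<Rightarrow> bool" ("\<Turnstile> _" [5] 5)
  where "(\<Turnstile> p) \<longleftrightarrow> p = \<^bold>\<top>"

text \<open>Quantifiers over the elements of a subset, given by its truth-valued membership predicate.\<close>

definition hBall :: "('a \<Rightarrow> 'h::complete_heyting_algebra) \<Rightarrow> ('a \<Rightarrow> 'h) \<Rightarrow> 'h"
  where "hBall A \<phi> = (INF x. A x \<^bold>\<longrightarrow> \<phi> x)"

definition hBex :: "('a \<Rightarrow> 'h::complete_heyting_algebra) \<Rightarrow> ('a \<Rightarrow> 'h) \<Rightarrow> 'h"
  where "hBex A \<phi> = (SUP x. A x \<^bold>\<and> \<phi> x)"

syntax
  "_hBall" :: "pttrn \<Rightarrow> 'b \<Rightarrow> 'h \<Rightarrow> 'h" ("(3\<^bold>\<forall>_\<^bold>\<in>_./ _)" [0, 51, 10] 10)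
  "_hBex" :: "pttrn \<Rightarrow> 'b \<Rightarrow> 'h \<Rightarrow> 'h" ("(3\<^bold>\<exists>_\<^bold>\<in>_./ _)" [0, 51, 10] 10)
translations
  "\<^bold>\<forall>x\<^bold>\<in>A. p" \<rightleftharpoons> "CONST hBall A (\<lambda>x. p)"
  "\<^bold>\<exists>x\<^bold>\<in>A. p" \<rightleftharpoons> "CONST hBex A (\<lambda>x. p)"

text \<open>
  A set in this logic has a truth-valued equality; the truth value of \<open>x = x\<close> is the extent
  to which \<open>x\<close> exists, that is, belongs to the set.  Subsets and relations must be strict
  (they hold only of existing elements) and extensional.
\<close>

record ('a, 'h) ordered_set =
  eq :: "'a \<Rightarrow> 'a \<Rightarrow> 'h"  (infix "\<^bold>=\<index>" 55)
  le :: "'a \<Rightarrow> 'a \<Rightarrow> 'h"  (infix "\<^bold>\<sqsubseteq>\<index>" 55)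

definition ordered_set :: "('a, 'h::complete_heyting_algebra) ordered_set \<Rightarrow> bool" where
  "ordered_set D \<longleftrightarrow>
     (\<forall>x y. x \<^bold>=\<^bsub>D\<^esub> y \<le> y \<^bold>=\<^bsub>D\<^esub> x) \<and>
     (\<forall>x y z. (x \<^bold>=\<^bsub>D\<^esub> y \<^bold>\<and> y \<^bold>=\<^bsub>D\<^esub> z) \<le> x \<^bold>=\<^bsub>D\<^esub> z) \<and>
     (\<forall>x y. x \<^bold>\<sqsubseteq>\<^bsub>D\<^esub> y \<le> (x \<^bold>=\<^bsub>D\<^esub> x \<^bold>\<and> y \<^bold>=\<^bsub>D\<^esub> y)) \<and>
     (\<forall>x x' y y'. (x \<^bold>\<sqsubseteq>\<^bsub>D\<^esub> y \<^bold>\<and> x \<^bold>=\<^bsub>D\<^esub> x' \<^bold>\<and> y \<^bold>=\<^bsub>D\<^esub> y') \<le> x' \<^bold>\<sqsubseteq>\<^bsub>D\<^esub> y')"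

definition elements :: "('a, 'h::complete_heyting_algebra) ordered_set \<Rightarrow> 'a \<Rightarrow> 'h" ("\<^bold>|_\<^bold>|")
  where "\<^bold>|D\<^bold>| x = (x \<^bold>=\<^bsub>D\<^esub> x)"

definition subsets :: "('a, 'h::complete_heyting_algebra) ordered_set \<Rightarrow> ('a \<Rightarrow> 'h) set" where
  "subsets D =
     {S. (\<forall>x. S x \<le> \<^bold>|D\<^bold>| x) \<and> (\<forall>x y. (S x \<^bold>\<and> x \<^bold>=\<^bsub>D\<^esub> y) \<le> S y)}"

definition hAll_subset ::
    "('a, 'h::complete_heyting_algebra) ordered_set \<Rightarrow> (('a \<Rightarrow> 'h) \<Rightarrow> 'h) \<Rightarrow> 'h"
  where "hAll_subset D \<Phi> = (INF S\<in>subsets D. \<Phi> S)"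

definition hEx_subset ::
    "('a, 'h::complete_heyting_algebra) ordered_set \<Rightarrow> (('a \<Rightarrow> 'h) \<Rightarrow> 'h) \<Rightarrow> 'h"
  where "hEx_subset D \<Phi> = (SUP S\<in>subsets D. \<Phi> S)"

syntax
  "_hAll_subset" :: "pttrn \<Rightarrow> 'b \<Rightarrow> 'h \<Rightarrow> 'h" ("(3\<^bold>\<forall>_\<^bold>\<subseteq>_./ _)" [0, 51, 10] 10)
  "_hEx_subset" :: "pttrn \<Rightarrow> 'b \<Rightarrow> 'h \<Rightarrow> 'h" ("(3\<^bold>\<exists>_\<^bold>\<subseteq>_./ _)" [0, 51, 10] 10)
translations
  "\<^bold>\<forall>S\<^bold>\<subseteq>D. p" \<rightleftharpoons> "CONST hAll_subset D (\<lambda>S. p)"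
  "\<^bold>\<exists>S\<^bold>\<subseteq>D. p" \<rightleftharpoons> "CONST hEx_subset D (\<lambda>S. p)"

definition poset :: "('a, 'h::complete_heyting_algebra) ordered_set \<Rightarrow> 'h" where
  "poset D =
     ((\<^bold>\<forall>x\<^bold>\<in>\<^bold>|D\<^bold>|. x \<^bold>\<sqsubseteq>\<^bsub>D\<^esub> x) \<^bold>\<and>
      (\<^bold>\<forall>x\<^bold>\<in>\<^bold>|D\<^bold>|. \<^bold>\<forall>y\<^bold>\<in>\<^bold>|D\<^bold>|. \<^bold>\<forall>z\<^bold>\<in>\<^bold>|D\<^bold>|. x \<^bold>\<sqsubseteq>\<^bsub>D\<^esub> y \<^bold>\<longrightarrow> y \<^bold>\<sqsubseteq>\<^bsub>D\<^esub> z \<^bold>\<longrightarrow> x \<^bold>\<sqsubseteq>\<^bsub>D\<^esub> z) \<^bold>\<and>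
      (\<^bold>\<forall>x\<^bold>\<in>\<^bold>|D\<^bold>|. \<^bold>\<forall>y\<^bold>\<in>\<^bold>|D\<^bold>|. x \<^bold>\<sqsubseteq>\<^bsub>D\<^esub> y \<^bold>\<longrightarrow> y \<^bold>\<sqsubseteq>\<^bsub>D\<^esub> x \<^bold>\<longrightarrow> x \<^bold>=\<^bsub>D\<^esub> y))"

definition directed ::
    "('a, 'h::complete_heyting_algebra) ordered_set \<Rightarrow> ('a \<Rightarrow> 'h) \<Rightarrow> 'h" where
  "directed D S =
     ((\<^bold>\<exists>x\<^bold>\<in>S. \<^bold>\<top>) \<^bold>\<and>
      (\<^bold>\<forall>x\<^bold>\<in>S. \<^bold>\<forall>y\<^bold>\<in>S. \<^bold>\<exists>z\<^bold>\<in>S. x \<^bold>\<sqsubseteq>\<^bsub>D\<^esub> z \<^bold>\<and> y \<^bold>\<sqsubseteq>\<^bsub>D\<^esub> z))"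

definition is_supremum ::
    "('a, 'h::complete_heyting_algebra) ordered_set \<Rightarrow> ('a \<Rightarrow> 'h) \<Rightarrow> 'a \<Rightarrow> 'h" where
  "is_supremum D S d =
     ((\<^bold>\<forall>s\<^bold>\<in>S. s \<^bold>\<sqsubseteq>\<^bsub>D\<^esub> d) \<^bold>\<and>
      (\<^bold>\<forall>u\<^bold>\<in>\<^bold>|D\<^bold>|. (\<^bold>\<forall>s\<^bold>\<in>S. s \<^bold>\<sqsubseteq>\<^bsub>D\<^esub> u) \<^bold>\<longrightarrow> d \<^bold>\<sqsubseteq>\<^bsub>D\<^esub> u))"

text \<open>
  A supremum exists in the sense of the internal logic, which need not name an element of \<open>'a\<close>;
  so a condition on the supremum of \<open>S\<close> is stated for every \<open>d\<close> that is a supremum of \<open>S\<close>.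
\<close>

definition dcpo :: "('a, 'h::complete_heyting_algebra) ordered_set \<Rightarrow> 'h" where
  "dcpo D =
     (poset D \<^bold>\<and>
      (\<^bold>\<forall>S\<^bold>\<subseteq>D. directed D S \<^bold>\<longrightarrow> (\<^bold>\<exists>d\<^bold>\<in>\<^bold>|D\<^bold>|. is_supremum D S d)))"

definition way_below ::
    "('a, 'h::complete_heyting_algebra) ordered_set \<Rightarrow> 'a \<Rightarrow> 'a \<Rightarrow> 'h" where
  "way_below D x y =
     (\<^bold>\<forall>S\<^bold>\<subseteq>D. directed D S \<^bold>\<longrightarrow>
        (\<^bold>\<forall>d\<^bold>\<in>\<^bold>|D\<^bold>|. is_supremum D S d \<^bold>\<longrightarrow> y \<^bold>\<sqsubseteq>\<^bsub>D\<^esub> d \<^bold>\<longrightarrow> (\<^bold>\<exists>s\<^bold>\<in>S. x \<^bold>\<sqsubseteq>\<^bsub>D\<^esub> s)))"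

definition way_below_set ::
    "('a, 'h::complete_heyting_algebra) ordered_set \<Rightarrow> 'a \<Rightarrow> 'a \<Rightarrow> 'h" where
  "way_below_set D x = (\<lambda>y. \<^bold>|D\<^bold>| y \<^bold>\<and> way_below D y x)"

definition continuous :: "('a, 'h::complete_heyting_algebra) ordered_set \<Rightarrow> 'h" where
  "continuous D =
     (\<^bold>\<forall>x\<^bold>\<in>\<^bold>|D\<^bold>|. directed D (way_below_set D x) \<^bold>\<and> is_supremum D (way_below_set D x) x)"

definition scott_open ::
    "('a, 'h::complete_heyting_algebra) ordered_set \<Rightarrow> ('a \<Rightarrow> 'h) \<Rightarrow> 'h" where
  "scott_open D U =
     ((\<^bold>\<forall>x\<^bold>\<in>\<^bold>|D\<^bold>|. \<^bold>\<forall>y\<^bold>\<in>\<^bold>|D\<^bold>|. U x \<^bold>\<longrightarrow> x \<^bold>\<sqsubseteq>\<^bsub>D\<^esub> y \<^bold>\<longrightarrow> U y) \<^bold>\<and>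
      (\<^bold>\<forall>S\<^bold>\<subseteq>D. directed D S \<^bold>\<longrightarrow>
         (\<^bold>\<forall>d\<^bold>\<in>\<^bold>|D\<^bold>|. is_supremum D S d \<^bold>\<longrightarrow> U d \<^bold>\<longrightarrow> (\<^bold>\<exists>s\<^bold>\<in>S. U s))))"

definition hausdorff_separated ::
    "('a, 'h::complete_heyting_algebra) ordered_set \<Rightarrow> 'a \<Rightarrow> 'a \<Rightarrow> 'h" where
  "hausdorff_separated D x y =
     (\<^bold>\<exists>U\<^bold>\<subseteq>D. \<^bold>\<exists>V\<^bold>\<subseteq>D. scott_open D U \<^bold>\<and> scott_open D V \<^bold>\<and> U x \<^bold>\<and> V y \<^bold>\<and>
        (\<^bold>\<forall>z\<^bold>\<in>\<^bold>|D\<^bold>|. \<^bold>\<not> (U z \<^bold>\<and> V z)))"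

definition strongly_maximal ::
    "('a, 'h::complete_heyting_algebra) ordered_set \<Rightarrow> 'a \<Rightarrow> 'h" where
  "strongly_maximal D x =
     (\<^bold>\<forall>u\<^bold>\<in>\<^bold>|D\<^bold>|. \<^bold>\<forall>v\<^bold>\<in>\<^bold>|D\<^bold>|. way_below D u v \<^bold>\<longrightarrow>
        way_below D u x \<^bold>\<or> hausdorff_separated D v x)"

definition sharp ::
    "('a, 'h::complete_heyting_algebra) ordered_set \<Rightarrow> 'a \<Rightarrow> 'h" where
  "sharp D x =
     (\<^bold>\<forall>y\<^bold>\<in>\<^bold>|D\<^bold>|. \<^bold>\<forall>z\<^bold>\<in>\<^bold>|D\<^bold>|. way_below D y z \<^bold>\<longrightarrow>
        way_below D y x \<^bold>\<or> \<^bold>\<not> (z \<^bold>\<sqsubseteq>\<^bsub>D\<^esub> x))"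

end

theory Submission
  imports Defs
begin

text \<open>
  If \<open>z\<close> and \<open>x\<close> have disjoint Scott open neighbourhoods \<open>U\<close> and \<open>V\<close>, then \<open>z \<sqsubseteq> x\<close> would put
  \<open>x\<close> into the upper set \<open>U\<close>, hence into both.  So Hausdorff separation of \<open>z\<close>
  from \<open>x\<close> refutes \<open>z \<sqsubseteq> x\<close>, which turns strong maximality into sharpness.
\<close>

text \<open>The Heyting adjunction. Left to right is modus ponens, which needs meets to distribute
  over the join defining the implication; right to left, \<open>w\<close> is one of the joined
  elements.\<close>

lemma le_hImp_iff: "w \<le> (p \<^bold>\<longrightarrow> q) \<longleftrightarrow> (w \<^bold>\<and> p) \<le> q"
proof
  have "(p \<^bold>\<and> (p \<^bold>\<longrightarrow> q)) \<le> (SUP r\<in>{r. (r \<^bold>\<and> p) \<le> q}. p \<^bold>\<and> r)"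
    unfolding hImp_def by (rule inf_Sup_le)
  also have "\<dots> \<le> q"
    by (rule SUP_least) (simp add: inf.commute)
  finally have mp: "(p \<^bold>\<and> (p \<^bold>\<longrightarrow> q)) \<le> q" .
  assume "w \<le> (p \<^bold>\<longrightarrow> q)"
  then have "(w \<^bold>\<and> p) \<le> (p \<^bold>\<and> (p \<^bold>\<longrightarrow> q))"
    by (simp add: le_infI1)
  then show "(w \<^bold>\<and> p) \<le> q"
    using mp by (rule order_trans)
next
  assume "(w \<^bold>\<and> p) \<le> q"
  then show "w \<le> (p \<^bold>\<longrightarrow> q)"
    unfolding hImp_def by (simp add: Sup_upper)
qed

text \<open>Reading \<open>w \<le> p\<close> as: \<open>p\<close> holds in context \<open>w\<close>,
  this rule and the next ones give natural deduction for the internal logic.\<close>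

lemma hImpD: "w \<le> (p \<^bold>\<longrightarrow> q) \<Longrightarrow> w \<le> p \<Longrightarrow> w \<le> q"
  by (metis le_hImp_iff inf.absorb1)

lemma hBallD: "w \<le> hBall A \<phi> \<Longrightarrow> w \<le> A x \<Longrightarrow> w \<le> \<phi> x"
  unfolding hBall_def le_INF_iff by (blast intro: hImpD)

lemma hBallI: "(\<And>x. (w \<^bold>\<and> A x) \<le> \<phi> x) \<Longrightarrow> w \<le> hBall A \<phi>"
  unfolding hBall_def by (rule INF_greatest) (simp add: le_hImp_iff)

lemma hEx_subset_least: "(\<And>S. S \<in> subsets D \<Longrightarrow> \<Phi> S \<le> w) \<Longrightarrow> hEx_subset D \<Phi> \<le> w"
  unfolding hEx_subset_def by (rule SUP_least)

lemma valid_hImp_iff: "(\<Turnstile> p \<^bold>\<longrightarrow> q) \<longleftrightarrow> p \<le> q"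
  unfolding valid_def top_unique[symmetric] le_hImp_iff by simp

lemma scott_open_upper:
  assumes "w \<le> scott_open D U" "w \<le> \<^bold>|D\<^bold>| x" "w \<le> \<^bold>|D\<^bold>| y" "w \<le> U x" "w \<le> x \<^bold>\<sqsubseteq>\<^bsub>D\<^esub> y"
  shows "w \<le> U y"
proof -
  have "w \<le> (\<^bold>\<forall>x\<^bold>\<in>\<^bold>|D\<^bold>|. \<^bold>\<forall>y\<^bold>\<in>\<^bold>|D\<^bold>|. U x \<^bold>\<longrightarrow> x \<^bold>\<sqsubseteq>\<^bsub>D\<^esub> y \<^bold>\<longrightarrow> U y)"
    using assms(1) by (simp add: scott_open_def)
  from hBallD[OF hBallD[OF this assms(2)] assms(3)] show ?thesis
    using assms(4,5) by (blast intro: hImpD)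
qed

lemma hausdorff_separated_le_not_le:
  assumes "ordered_set D"
  shows "hausdorff_separated D z x \<le> (\<^bold>\<not> (z \<^bold>\<sqsubseteq>\<^bsub>D\<^esub> x))"
  unfolding hausdorff_separated_def
proof (intro hEx_subset_least)
  fix U V :: "'a \<Rightarrow> 'b"
  let ?disjoint = "\<^bold>\<forall>z\<^bold>\<in>\<^bold>|D\<^bold>|. \<^bold>\<not> (U z \<^bold>\<and> V z)"
  let ?body = "scott_open D U \<^bold>\<and> scott_open D V \<^bold>\<and> U z \<^bold>\<and> V x \<^bold>\<and> ?disjoint"
  \<comment> \<open>By the adjunction, refuting the inequality in context \<open>?body\<close> means
    showing that this enlarged context is below falsity.\<close>
  let ?w = "?body \<^bold>\<and> z \<^bold>\<sqsubseteq>\<^bsub>D\<^esub> x"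
  have le: "?w \<le> z \<^bold>\<sqsubseteq>\<^bsub>D\<^esub> x" by simp
  \<comment> \<open>Strictness of the order: the inequality itself supplies the existence of
    \<open>z\<close> and \<open>x\<close>, which the bounded quantifiers in
    \<open>scott_open\<close> and \<open>?disjoint\<close> require.\<close>
  have "z \<^bold>\<sqsubseteq>\<^bsub>D\<^esub> x \<le> (\<^bold>|D\<^bold>| z \<^bold>\<and> \<^bold>|D\<^bold>| x)"
    using assms by (simp add: ordered_set_def elements_def)
  with le have "?w \<le> (\<^bold>|D\<^bold>| z \<^bold>\<and> \<^bold>|D\<^bold>| x)" by (rule order_trans)
  then have ex: "?w \<le> \<^bold>|D\<^bold>| z" "?w \<le> \<^bold>|D\<^bold>| x" by (simp_all only: le_inf_iff)
  have parts: "?w \<le> scott_open D U" "?w \<le> U z" "?w \<le> V x" "?w \<le> ?disjoint"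
    by (simp_all add: le_infI1 le_infI2)
  have "?w \<le> U x"
    by (rule scott_open_upper[OF parts(1) ex parts(2) le])
  with parts(3) have "?w \<le> (U x \<^bold>\<and> V x)" by (simp only: le_inf_iff)
  with hBallD[OF parts(4) ex(2)] have "?w \<le> \<^bold>\<bottom>" by (rule hImpD)
  then show "?body \<le> (\<^bold>\<not> (z \<^bold>\<sqsubseteq>\<^bsub>D\<^esub> x))" by (simp only: le_hImp_iff)
qed

lemma strongly_maximal_le_sharp:
  assumes "ordered_set D"
  shows "strongly_maximal D x \<le> sharp D x"
  unfolding sharp_def
proof (intro hBallI)
  fix y z
  \<comment> \<open>The context left by the two uses of \<open>hBallI\<close>; \<open>y\<close> and
    \<open>z\<close> will instantiate \<open>u\<close> and \<open>v\<close> in strong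
    maximality.\<close>
  let ?w = "(strongly_maximal D x \<^bold>\<and> \<^bold>|D\<^bold>| y) \<^bold>\<and> \<^bold>|D\<^bold>| z"
  have mem: "?w \<le> \<^bold>|D\<^bold>| y" "?w \<le> \<^bold>|D\<^bold>| z"
    by (simp_all add: le_infI1)
  have "?w \<le> (\<^bold>\<forall>u\<^bold>\<in>\<^bold>|D\<^bold>|. \<^bold>\<forall>v\<^bold>\<in>\<^bold>|D\<^bold>|. way_below D u v \<^bold>\<longrightarrow>
      way_below D u x \<^bold>\<or> hausdorff_separated D v x)"
    by (simp add: le_infI1 flip: strongly_maximal_def)
  from hBallD[OF hBallD[OF this mem(1)] mem(2)]
  have "(?w \<^bold>\<and> way_below D y z) \<le> (way_below D y x \<^bold>\<or> hausdorff_separated D z x)"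
    by (simp only: le_hImp_iff)
  also have "\<dots> \<le> (way_below D y x \<^bold>\<or> \<^bold>\<not> (z \<^bold>\<sqsubseteq>\<^bsub>D\<^esub> x))"
    using hausdorff_separated_le_not_le[OF assms] by (rule sup_mono[OF order_refl])
  finally show "?w \<le> (way_below D y z \<^bold>\<longrightarrow> way_below D y x \<^bold>\<or> \<^bold>\<not> (z \<^bold>\<sqsubseteq>\<^bsub>D\<^esub> x))"
    by (simp only: le_hImp_iff)
qed

theorem proposition6p3:
  fixes D :: "('a, 'h::complete_heyting_algebra) ordered_set"
  assumes "ordered_set D"
  shows "\<Turnstile> dcpo D \<^bold>\<and> continuous D \<^bold>\<longrightarrow>
           (\<^bold>\<forall>x\<^bold>\<in>\<^bold>|D\<^bold>|. strongly_maximal D x \<^bold>\<longrightarrow> sharp D x)"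
  unfolding valid_hImp_iff
  by (intro hBallI) (simp add: le_hImp_iff le_infI2 strongly_maximal_le_sharp[OF assms])

end
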